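(* Let $1\le q<3$ and let $Y$ be a real random variable following the standard (central) $q$-Gaussian distribution $N_q(0,1)$. Then the coefficient of kurtosis of $Y$ is $$\mathrm{Kurt}[Y]=\frac{E(Y^4)}{(E(Y^2))^2}=\frac{3(5-3q)}{7-5q},\qquad 1\le q<\frac75 .$$
   Context: For real $q$ and $u$, the $q$-exponential is $e_q^{u}=e_q(u)=[1+(1-q)u]_+^{1/(1-q)}$ for $q\ne 1$, and $e_1^{u}=\exp(u)$. For $1\le q<3$ put $\beta=\frac{1}{3-q}$ and $C_q=\int_{-\infty}^{\infty}e_q^{-x^2}\,dx$, so that $C_1=\sqrt{\pi}$ and $C_q=\left(\frac{1}{q-1}\right)^{1/2}B\!\left(\frac{3-q}{2(q-1)},\frac12\right)$ for $1<q<3$, where $B$ is the beta function. The standard $q$-Gaussian distribution $N_q(0,1)$ is the probability distribution on $\mathbb{R}$ with density $y\mapsto \frac{\sqrt{\beta}}{C_q}e_q^{-\beta y^2}$. $E$ denotes the usual expectation. *)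

theory Defs
  imports "HOL-Probability.Probability"
begin

text \<open>
  The positive part \<open>[a]\<^sub>+\<close> is \<open>max 0 a\<close>. In Isabelle,
  \<open>0 powr a = 0\<close> for every \<open>a\<close>; for \<open>q \<ge> 1\<close> and \<open>u \<le> 0\<close>, the only range relevant for the
  densities below, the base is at least 1 and this convention plays no role.
\<close>

definition q_exp :: "real \<Rightarrow> real \<Rightarrow> real" where
  "q_exp q u = (if q = 1 then exp u else (max 0 (1 + (1 - q) * u)) powr (1 / (1 - q)))"

definition q_beta :: "real \<Rightarrow> real" where
  "q_beta q = 1 / (3 - q)"

definition q_const :: "real \<Rightarrow> real" where
  "q_const q = (LINT x|lborel. q_exp q (- (x ^ 2)))"

definition q_gaussian_density :: "real \<Rightarrow> real \<Rightarrow> real" where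
  "q_gaussian_density q y = sqrt (q_beta q) / q_const q * q_exp q (- (q_beta q * y ^ 2))"

text \<open>
  The coefficient of kurtosis is the fourth central moment divided by the square of the variance
  (no subtraction of 3). It is meaningful only if the fourth moment exists.
\<close>

definition (in prob_space) kurtosis :: "('a \<Rightarrow> real) \<Rightarrow> real" where
  "kurtosis X = expectation (\<lambda>\<omega>. (X \<omega> - expectation X) ^ 4) / (variance X) ^ 2"

end

theory Submission
  imports Defs "HOL-Real_Asymp.Real_Asymp"
begin

text \<open>
  Put \<open>f x = e\<^sub>q(- b x\<^sup>2)\<close> with \<open>b = 1 / (3 - q)\<close>. The density is a constant multiple of \<open>f\<close>;
  the constant enters only through the total mass 1, because integration by parts relates each
  even moment to the preceding one. The function
  \<open>w x = (1 + (q - 1) b x\<^sup>2) f x\<close> satisfies \<open>w' x = - 2 (2 - q) b x f x\<close>, for \<open>q = 1\<close> as well as for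
  \<open>q > 1\<close>. Hence the derivative of \<open>x\<^sup>k w x\<close> is
  \<open>k x^(k-1) f x - b (2 (2 - q) - k (q - 1)) x^(k+1) f x\<close>,
  and as soon as \<open>k (q - 1) < 2 (2 - q)\<close> the boundary terms \<open>x\<^sup>k w x\<close> vanish at infinity (lemma
  \<open>boundary_term_tendsto_0\<close>). For odd \<open>k\<close> the integrand \<open>x^(k+1) f x\<close> is nonnegative, so
  monotone convergence over \<open>[-n, n]\<close> gives its integrability together with the
  value of its integral (lemma \<open>q_exp_moment_recursion\<close>).

  Starting from \<open>E(Y\<^sup>0) = 1\<close>, the cases \<open>k = 1\<close> and \<open>k = 3\<close> give \<open>E(Y\<^sup>2) = 1 / (b (5 - 3q))\<close> and
  \<open>E(Y\<^sup>4) = 3 E(Y\<^sup>2) / (b (7 - 5q))\<close>; the condition for \<open>k = 3\<close> is exactly \<open>q < 7/5\<close>. In the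
  quotient \<open>b\<close> cancels. The density is even, so \<open>E(Y) = 0\<close> and central moments agree with moments.
\<close>

lemma q_exp_neg_square:
  fixes b q x :: real
  assumes "1 < q" "0 \<le> b"
  shows "q_exp q (- (b * x\<^sup>2)) = (1 + (q - 1) * b * x\<^sup>2) powr (- (1 / (q - 1)))"
proof -
  have "0 \<le> (q - 1) * b * x\<^sup>2" using assms by simp
  moreover have "1 + (1 - q) * - (b * x\<^sup>2) = 1 + (q - 1) * b * x\<^sup>2" by (simp add: algebra_simps)
  moreover have "1 / (1 - q) = - (1 / (q - 1))" using assms by (simp add: field_simps)
  ultimately show ?thesis using assms by (simp add: q_exp_def)
qed

lemma weighted_q_exp_eq_powr:
  fixes b q x :: real
  assumes "1 < q" "0 \<le> b"
  shows "(1 + (q - 1) * b * x\<^sup>2) * q_exp q (- (b * x\<^sup>2))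
    = (1 + (q - 1) * b * x\<^sup>2) powr (1 - 1 / (q - 1))"
proof -
  have "0 < 1 + (q - 1) * b * x\<^sup>2"
    using assms by (smt (verit) mult_nonneg_nonneg zero_le_power2)
  then show ?thesis
    using powr_add[of "1 + (q - 1) * b * x\<^sup>2" 1 "- (1 / (q - 1))"] assms
    by (simp add: q_exp_neg_square)
qed

lemma q_exp_nonneg: "0 \<le> q_exp q u"
  by (simp add: q_exp_def)

lemma continuous_q_exp_neg_square:
  assumes "1 \<le> q" "0 \<le> b"
  shows "isCont (\<lambda>x. q_exp q (- (b * x\<^sup>2))) x"
proof (cases "q = 1")
  case True
  then show ?thesis by (simp add: q_exp_def)
next
  case False
  then have "1 < q" using assms by simp
  moreover have "1 + (q - 1) * b * x\<^sup>2 \<noteq> 0"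
    using assms by (smt (verit) mult_nonneg_nonneg zero_le_power2)
  ultimately show ?thesis using assms
    by (simp add: q_exp_neg_square) (intro continuous_intros, auto)
qed

text \<open>
  The \<open>q\<close>-exponential solves \<open>y' = y\<^sup>q\<close>, so differentiating it alone changes the power unless \<open>q = 1\<close>.
  The weight \<open>1 + (q - 1) b x\<^sup>2 = e\<^sub>q(- b x\<^sup>2) powr (1 - q)\<close> compensates for this: the derivative of
  the product is again the \<open>q\<close>-exponential, up to a factor linear in \<open>x\<close>.
\<close>

lemma DERIV_weighted_q_exp:
  fixes b q x :: real
  assumes "1 \<le> q" "0 \<le> b"
  shows "((\<lambda>x. (1 + (q - 1) * b * x\<^sup>2) * q_exp q (- (b * x\<^sup>2)))
    has_real_derivative - (2 * (2 - q) * b * x * q_exp q (- (b * x\<^sup>2)))) (at x)"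
proof (cases "q = 1")
  case True
  then show ?thesis
    by (auto simp: q_exp_def intro!: derivative_eq_intros)
next
  case False
  then have q: "1 < q" using assms by simp
  define s where "s = 1 / (q - 1)"
  have pos: "0 < 1 + (q - 1) * b * y\<^sup>2" for y
    using q assms by (smt (verit) mult_nonneg_nonneg zero_le_power2)
  have "(1 + (q - 1) * b * y\<^sup>2) * q_exp q (- (b * y\<^sup>2)) = (1 + (q - 1) * b * y\<^sup>2) powr (1 - s)" for y
    using weighted_q_exp_eq_powr[OF q assms(2)] by (simp add: s_def)
  moreover have "((\<lambda>x. (1 + (q - 1) * b * x\<^sup>2) powr (1 - s)) has_real_derivative
      (1 - s) * (1 + (q - 1) * b * x\<^sup>2) powr (1 - s - 1) * ((q - 1) * b * (2 * x))) (at x)"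
    using pos by (auto intro!: derivative_eq_intros)
  moreover have "(1 - s) * (1 + (q - 1) * b * x\<^sup>2) powr (1 - s - 1) * ((q - 1) * b * (2 * x))
      = - (2 * (2 - q) * b * x * q_exp q (- (b * x\<^sup>2)))"
  proof -
    have "(1 - s) * (q - 1) = q - 2"
      using q by (simp add: s_def field_simps)
    moreover have "q_exp q (- (b * x\<^sup>2)) = (1 + (q - 1) * b * x\<^sup>2) powr (1 - s - 1)"
      using q assms by (simp add: q_exp_neg_square s_def)
    moreover have "(1 - s) * P * ((q - 1) * b * (2 * x)) = (1 - s) * (q - 1) * (2 * b * x * P)" for P
      by (simp only: mult_ac)
    ultimately show ?thesis by (simp only:) (simp add: algebra_simps)
  qed
  ultimately show ?thesis by simp
qed

text \<open>
  For \<open>q > 1\<close> the weighted function decays like \<open>x powr (2 (1 - s))\<close> with \<open>s = 1 / (q - 1)\<close>, and the third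
  assumption is the condition \<open>k + 2 (1 - s) < 0\<close> multiplied by \<open>q - 1\<close>, a form that also makes
  sense at \<open>q = 1\<close>.
\<close>

lemma boundary_term_tendsto_0:
  fixes b q :: real and k :: nat
  assumes "1 \<le> q" "0 < b" "k * (q - 1) < 2 * (2 - q)"
  shows "((\<lambda>x. x ^ k * ((1 + (q - 1) * b * x\<^sup>2) * q_exp q (- (b * x\<^sup>2)))) \<longlongrightarrow> 0) at_top"
proof (cases "q = 1")
  case True
  have "((\<lambda>x. x ^ k * exp (- (b * x\<^sup>2))) \<longlongrightarrow> 0) at_top"
    using assms(2) by real_asymp
  then show ?thesis using True by (simp add: q_exp_def)
next
  case False
  then have q: "1 < q" using assms by simp
  define s where "s = 1 / (q - 1)"
  define c where "c = (q - 1) * b"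
  have c: "0 < c" using q assms by (simp add: c_def)
  have s: "k + 2 * (1 - s) < 0"
    using assms(3) q by (simp add: s_def field_simps)
  have eq: "x ^ k * ((1 + (q - 1) * b * x\<^sup>2) * q_exp q (- (b * x\<^sup>2)))
      = x ^ k * (1 + c * x\<^sup>2) powr (1 - s)" for x
    using weighted_q_exp_eq_powr[OF q, of b x] assms(2) by (simp add: s_def c_def)
  have "((\<lambda>x. c powr (1 - s) * x powr (k + 2 * (1 - s))) \<longlongrightarrow> 0) at_top"
    using tendsto_mult_left[OF tendsto_neg_powr[OF s filterlim_ident], of "c powr (1 - s)"] by simp
  moreover have "eventually (\<lambda>x. norm (x ^ k * (1 + c * x\<^sup>2) powr (1 - s))
      \<le> c powr (1 - s) * x powr (k + 2 * (1 - s))) at_top"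
    using eventually_gt_at_top[of 0]
  proof eventually_elim
    case (elim x)
    have "(1 + c * x\<^sup>2) powr (1 - s) \<le> (c * x\<^sup>2) powr (1 - s)"
      using elim c s by (intro powr_mono2') auto
    also have "(c * x\<^sup>2) powr (1 - s) = c powr (1 - s) * x powr (2 * (1 - s))"
      using elim c by (simp add: powr_mult powr_powr flip: powr_numeral)
    finally have "x ^ k * (1 + c * x\<^sup>2) powr (1 - s) \<le> x ^ k * (c powr (1 - s) * x powr (2 * (1 - s)))"
      using elim by (intro mult_left_mono) auto
    then show ?case using elim by (simp add: powr_add powr_realpow mult_ac)
  qed
  ultimately show ?thesis unfolding eq by (rule Lim_null_comparison[rotated])
qed

lemma truncation_tendsto:
  fixes y :: real
  shows "(\<lambda>n. y * indicator {- real n..real n} x) \<longlonglongrightarrow> y"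
proof (rule tendsto_eventually)
  show "\<forall>\<^sub>F n in sequentially. y * indicator {- real n..real n} x = y"
    using eventually_ge_at_top[of "nat \<lceil>\<bar>x\<bar>\<rceil>"]
    by eventually_elim (auto simp: indicator_def)
qed

text \<open>
  Integration by parts on \<open>[-n, n]\<close> expresses the truncated moment of order \<open>k + 1\<close> through the one
  of order \<open>k - 1\<close> and a boundary term that tends to 0. Since \<open>k\<close> is odd, the truncated
  integrands of order \<open>k + 1\<close> increase with \<open>n\<close>, and convergence of their integrals already implies
  that the limit function is integrable.
\<close>

lemma q_exp_moment_recursion:
  fixes b q :: real and k :: nat
  assumes "1 \<le> q" "0 < b" "k * (q - 1) < 2 * (2 - q)" "odd k"
    and int: "integrable lborel (\<lambda>x. x ^ (k - 1) * q_exp q (- (b * x\<^sup>2)))"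
  shows "has_bochner_integral lborel (\<lambda>x. x ^ (k + 1) * q_exp q (- (b * x\<^sup>2)))
    (k / (b * (2 * (2 - q) - k * (q - 1))) * (LINT x|lborel. x ^ (k - 1) * q_exp q (- (b * x\<^sup>2))))"
proof -
  define f where "f x = q_exp q (- (b * x\<^sup>2))" for x
  define a where "a = b * (2 * (2 - q) - k * (q - 1))"
  define G where "G x = x ^ k * ((1 + (q - 1) * b * x\<^sup>2) * f x)" for x
  define m where "m = (LINT x|lborel. x ^ (k - 1) * f x)"
  have a: "0 < a" using assms by (simp add: a_def)
  have f_nonneg: "0 \<le> f x" for x by (simp add: f_def q_exp_nonneg)
  have f_cont: "isCont f x" for x
    unfolding f_def using assms by (intro continuous_q_exp_neg_square) auto
  have f_meas [measurable]: "f \<in> borel_measurable borel"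
    using f_cont by (intro borel_measurable_continuous_onI) (simp add: continuous_at_imp_continuous_on)
  have cont: "isCont (\<lambda>x. x ^ j * f x) x" for j x
    by (intro continuous_intros f_cont)
  have G_deriv: "(G has_real_derivative k * (x ^ (k - 1) * f x) - a * (x ^ (k + 1) * f x)) (at x)" for x
  proof -
    obtain j where k: "k = Suc j" using \<open>odd k\<close> by (cases k) auto
    have "(G has_real_derivative (k * x ^ (k - 1)) * ((1 + (q - 1) * b * x\<^sup>2) * f x)
        + - (2 * (2 - q) * b * x * f x) * x ^ k) (at x)"
      unfolding G_def f_def
      using DERIV_mult[OF DERIV_pow[of k x] DERIV_weighted_q_exp[of q b x]] assms by simp
    then show ?thesis
      by (rule DERIV_cong) (simp add: a_def k algebra_simps power2_eq_square)
  qed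
  have G_odd: "G (- x) = - G x" for x
    using \<open>odd k\<close> by (simp add: G_def f_def)
  have G_lim: "(\<lambda>n. G (real n)) \<longlonglongrightarrow> 0"
    unfolding G_def f_def
    by (rule filterlim_compose[OF boundary_term_tendsto_0[OF assms(1-3)] filterlim_real_sequentially])
  define I where "I j n = (LINT x|lborel. x ^ j * f x * indicator {- real n..real n} x)" for j n
  have intI: "integrable lborel (\<lambda>x. x ^ j * f x * indicator {- real n..real n} x)" for j n
    using borel_integrable_atLeastAtMost[of "- real n" "real n" "\<lambda>x. x ^ j * f x"] cont
    by (simp add: mult.commute indicator_def if_distrib cong: if_cong)
  have parts: "a * I (k + 1) n = k * I (k - 1) n - 2 * G n" for n
  proof -
    have "(LINT x|lborel. (k * (x ^ (k - 1) * f x) - a * (x ^ (k + 1) * f x)) * indicator {- real n..real n} x)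
        = G n - G (- real n)"
      by (rule integral_FTC_Icc_real) (use G_deriv cont in \<open>auto intro!: continuous_intros simp del: power_Suc\<close>)
    also have "(LINT x|lborel. (k * (x ^ (k - 1) * f x) - a * (x ^ (k + 1) * f x)) * indicator {- real n..real n} x)
        = (LINT x|lborel. k * (x ^ (k - 1) * f x * indicator {- real n..real n} x)
            - a * (x ^ (k + 1) * f x * indicator {- real n..real n} x))"
      by (simp add: algebra_simps)
    also have "\<dots> = k * I (k - 1) n - a * I (k + 1) n"
      unfolding I_def
      by (subst Bochner_Integration.integral_diff) (auto intro!: integrable_mult_right intI simp del: power_Suc)
    finally show ?thesis by (simp add: G_odd)
  qed
  have "(\<lambda>n. I (k - 1) n) \<longlonglongrightarrow> m"
    unfolding I_def m_def
  proof (rule integral_dominated_convergence[where w = "\<lambda>x. \<bar>x ^ (k - 1) * f x\<bar>"])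
    show "AE x in lborel. (\<lambda>n. x ^ (k - 1) * f x * indicator {- real n..real n} x) \<longlonglongrightarrow> x ^ (k - 1) * f x"
      by (intro AE_I2 truncation_tendsto)
  qed (use int in \<open>auto simp: f_def[symmetric] indicator_def\<close>)
  then have "(\<lambda>n. (k * I (k - 1) n - 2 * G n) / a) \<longlonglongrightarrow> (k * m - 2 * 0) / a"
    using a by (intro tendsto_intros G_lim) auto
  moreover have "(\<lambda>n. (k * I (k - 1) n - 2 * G n) / a) = I (k + 1)"
    using a by (simp only: parts[symmetric]) simp
  ultimately have lim: "I (k + 1) \<longlonglongrightarrow> k / a * m"
    by simp
  have even: "0 \<le> x ^ (k + 1)" for x :: real
    using \<open>odd k\<close> by (intro zero_le_even_power) simp
  have "has_bochner_integral lborel (\<lambda>x. x ^ (k + 1) * f x) (k / a * m)"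
  proof (rule has_bochner_integral_monotone_convergence
      [where f = "\<lambda>n x. x ^ (k + 1) * f x * indicator {- real n..real n} x"])
    show "AE x in lborel. mono (\<lambda>n. x ^ (k + 1) * f x * indicator {- real n..real n} x)"
      using even f_nonneg
      by (intro AE_I2 monoI mult_left_mono mult_nonneg_nonneg) (auto simp: indicator_def)
    show "AE x in lborel. (\<lambda>n. x ^ (k + 1) * f x * indicator {- real n..real n} x) \<longlonglongrightarrow> x ^ (k + 1) * f x"
      by (intro AE_I2 truncation_tendsto)
  qed (use intI lim[unfolded I_def[abs_def]] in \<open>auto simp del: power_Suc\<close>)
  then show ?thesis by (simp add: f_def a_def m_def)
qed

theorem theorem5p3:
  fixes q :: real and M :: "'a measure" and Y :: "'a \<Rightarrow> real"
  assumes "1 \<le> q" and "q < 3"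
    and "prob_space M"
    and "distributed M lborel Y (\<lambda>y. ennreal (q_gaussian_density q y))"
    and "q < 7 / 5"
  shows "integrable M (\<lambda>\<omega>. Y \<omega> ^ 4)
    \<and> prob_space.kurtosis M Y =
        prob_space.expectation M (\<lambda>\<omega>. Y \<omega> ^ 4) / (prob_space.expectation M (\<lambda>\<omega>. Y \<omega> ^ 2)) ^ 2
    \<and> prob_space.expectation M (\<lambda>\<omega>. Y \<omega> ^ 4) / (prob_space.expectation M (\<lambda>\<omega>. Y \<omega> ^ 2)) ^ 2 =
        3 * (5 - 3 * q) / (7 - 5 * q)"
proof -
  interpret prob_space M by fact
  note dist = assms(4)
  define b where "b = q_beta q"
  define K where "K = sqrt b / q_const q"
  define f where "f x = q_exp q (- (b * x\<^sup>2))" for x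
  have b: "0 < b" using assms by (simp add: b_def q_beta_def)
  have f_nonneg: "0 \<le> f x" for x by (simp add: f_def q_exp_nonneg)
  have density: "q_gaussian_density q x = K * f x" for x
    by (simp add: q_gaussian_density_def K_def f_def b_def)
  have "0 \<le> q_const q"
    unfolding q_const_def by (intro Bochner_Integration.integral_nonneg q_exp_nonneg)
  then have K: "0 \<le> K" using b by (simp add: K_def)
  have f_meas [measurable]: "f \<in> borel_measurable borel"
    unfolding f_def using assms b
    by (intro borel_measurable_continuous_onI continuous_at_imp_continuous_on ballI
        continuous_q_exp_neg_square) auto
  have transfer: "integrable M (\<lambda>\<omega>. Y \<omega> ^ j) \<longleftrightarrow> integrable lborel (\<lambda>x. K * (x ^ j * f x))"
    "expectation (\<lambda>\<omega>. Y \<omega> ^ j) = K * (LINT x|lborel. x ^ j * f x)" for j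
    using distributed_integrable[OF dist, of "\<lambda>x. x ^ j"] distributed_integral[OF dist, of "\<lambda>x. x ^ j"]
      K f_nonneg by (simp_all add: density mult_ac)
  have total: "K * (LINT x|lborel. x ^ 0 * f x) = 1"
    using transfer(2)[of 0] by (simp add: prob_space)
  \<comment> \<open>A non-integrable function has Bochner integral 0, which would contradict the total mass 1.\<close>
  then have "integrable lborel f"
    using not_integrable_integral_eq[of lborel f] by (cases "integrable lborel f") auto
  have recursion: "has_bochner_integral lborel (\<lambda>x. x ^ (k + 1) * f x)
      (k / (b * (2 * (2 - q) - k * (q - 1))) * (LINT x|lborel. x ^ (k - 1) * f x))"
    if "k * (q - 1) < 2 * (2 - q)" "odd k" "integrable lborel (\<lambda>x. x ^ (k - 1) * f x)" for k
    using q_exp_moment_recursion[of q b k] that assms b by (simp add: f_def)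
  have coeff: "2 * (2 - q) - real 1 * (q - 1) = 5 - 3 * q" "2 * (2 - q) - real 3 * (q - 1) = 7 - 5 * q"
    by simp_all
  have m2: "has_bochner_integral lborel (\<lambda>x. x ^ 2 * f x) (1 / (b * (5 - 3 * q)) * (LINT x|lborel. f x))"
    using recursion[of 1] \<open>integrable lborel f\<close> assms unfolding coeff
    by (simp add: numeral_2_eq_2)
  have m4: "has_bochner_integral lborel (\<lambda>x. x ^ 4 * f x)
      (3 / (b * (7 - 5 * q)) * (LINT x|lborel. x ^ 2 * f x))"
    using recursion[of 3] m2 assms unfolding coeff
    by (simp add: has_bochner_integral_iff)
  have E2: "expectation (\<lambda>\<omega>. Y \<omega> ^ 2) = 1 / (b * (5 - 3 * q))"
    using m2 total transfer(2)[of 2] by (simp add: has_bochner_integral_iff field_simps)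
  have E4: "expectation (\<lambda>\<omega>. Y \<omega> ^ 4) = 3 / (b * (7 - 5 * q)) * expectation (\<lambda>\<omega>. Y \<omega> ^ 2)"
    using m4 by (simp add: transfer has_bochner_integral_iff)
  \<comment> \<open>The substitution \<open>x \<mapsto> -x\<close>.\<close>
  have "(LINT x|lborel. x * f x) = - (LINT x|lborel. x * f x)"
    using lborel_integral_real_affine[of "-1" "\<lambda>x. x * f x" 0] by (simp add: f_def)
  then have E1: "expectation Y = 0"
    using transfer(2)[of 1] by simp
  have "integrable M (\<lambda>\<omega>. Y \<omega> ^ 4)"
    using m4 by (simp add: transfer has_bochner_integral_iff)
  moreover have "kurtosis Y = expectation (\<lambda>\<omega>. Y \<omega> ^ 4) / (expectation (\<lambda>\<omega>. Y \<omega> ^ 2)) ^ 2"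
    by (simp add: kurtosis_def E1)
  moreover have "expectation (\<lambda>\<omega>. Y \<omega> ^ 4) / (expectation (\<lambda>\<omega>. Y \<omega> ^ 2)) ^ 2
      = 3 * (5 - 3 * q) / (7 - 5 * q)"
    unfolding E4 E2 using assms b by (simp add: power2_eq_square)
  ultimately show ?thesis by blast
qed

end
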